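(* Let $G$ be an abelian topological group in which every singleton is bounded. If $G$ is a complete group, then $\mathsf{Hom}_{\mathsf{bb}}(G)$, with the topology of uniform convergence on bounded sets, is also complete.
   Context: $e_G$ denotes the identity element of $G$. A subset $B$ of a topological group $G$ is bounded if for each neighborhood $U$ of $e_G$ there is a positive integer $n$ with $B\subset U^n$, where $U^n=\{u_1\cdots u_n:u_i\in U\}$. A (not necessarily continuous) group homomorphism $T:G\to G$ is $\mathsf{bb}$-bounded if for every bounded set $B\subset G$, $T(B)$ is bounded in $G$. $\mathsf{Hom}_{\mathsf{bb}}(G)$ is the group of all $\mathsf{bb}$-bounded homomorphisms $G\to G$ under the pointwise operations $(TS)(x):=T(x)S(x)$ and $T^{-1}(x):=(T(x))^{-1}$. It is endowed with the topology of uniform convergence on bounded sets: a net $(S_\alpha)$ converges to $S$ if for each bounded set $B\subset G$ and each neighborhood $V$ of $e_G$ there is an $\alpha_0$ with $(S_\alpha S^{-1})(B)\subset V$ for each $\alpha\ge\alpha_0$. Complete means that every Cauchy net converges to an element of the group. A net $(T_\alpha)$ in $\mathsf{Hom}_{\mathsf{bb}}(G)$ is Cauchy if for each bounded set $B\subset G$ and each neighborhood $V$ of $e_G$ there is an $\alpha_0$ with $(T_\alpha T_\beta^{-1})(B)\subset V$ for all $\alpha,\beta\ge\alpha_0$.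
   Formalization: The topological group G is assumed to be Hausdorff; for non-Hausdorff groups the claim can fail, because a Cauchy net of homomorphisms may have pointwise limits that cannot be chosen to form a homomorphism. *)

theory Defs
  imports "HOL-Analysis.Elementary_Topology" "HOL-Analysis.Abstract_Topology"
    "HOL-Library.Function_Algebras"
begin

text \<open>
  Groups are abelian and written additively.  The group operations on
  \<^typ>\<open>'a \<Rightarrow> 'a\<close> are the pointwise ones of \<^theory>\<open>HOL-Library.Function_Algebras\<close>.
  A neighborhood of 0 is a set with 0 in its interior, not necessarily open.
  Topological groups are understood to be Hausdorff; the theorem asks for this with the sort
  \<^class>\<open>t2_space\<close>.  Without it, pointwise limits of homomorphisms need not be choosable
  as homomorphisms, and completeness of \<open>hom_bb\<close> can fail.
\<close>

definition nfold_sum :: "'a::comm_monoid_add set \<Rightarrow> nat \<Rightarrow> 'a set" where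
  "nfold_sum U n = {\<Sum>i<n. u i | u. \<forall>i<n. u i \<in> U}"

definition group_bounded :: "'a::topological_ab_group_add set \<Rightarrow> bool" where
  "group_bounded B \<longleftrightarrow> (\<forall>U. 0 \<in> interior U \<longrightarrow> (\<exists>n>0. B \<subseteq> nfold_sum U n))"

definition hom_bb :: "('a::topological_ab_group_add \<Rightarrow> 'a) set" where
  "hom_bb = {T. additive T \<and> (\<forall>B. group_bounded B \<longrightarrow> group_bounded (T ` B))}"

definition ucb_ball ::
  "('a::topological_ab_group_add \<Rightarrow> 'a) \<Rightarrow> 'a set \<Rightarrow> 'a set \<Rightarrow> ('a \<Rightarrow> 'a) set" where
  "ucb_ball S B V = {T \<in> hom_bb. (T - S) ` B \<subseteq> V}"

text \<open>
  The topology of uniform convergence on bounded sets, with underlying set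
  \<open>hom_bb\<close>; \<open>net_converges_ucb_iff\<close> below describes its convergent nets.
\<close>

definition ucb_topology :: "('a::topological_ab_group_add \<Rightarrow> 'a) topology" where
  "ucb_topology = topology (\<lambda>X. X \<subseteq> hom_bb \<and>
     (\<forall>S\<in>X. \<exists>B V. group_bounded B \<and> 0 \<in> interior V \<and> ucb_ball S B V \<subseteq> X))"

text \<open>In a directed set \<open>(D, r)\<close>, the pair \<open>(a, b) \<in> r\<close> means that \<open>a\<close> precedes \<open>b\<close>.\<close>

definition directed :: "'i set \<Rightarrow> ('i \<times> 'i) set \<Rightarrow> bool" where
  "directed D r \<longleftrightarrow> D \<noteq> {} \<and> preorder_on D r \<and>
     (\<forall>a\<in>D. \<forall>b\<in>D. \<exists>c\<in>D. (a, c) \<in> r \<and> (b, c) \<in> r)"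

definition net_converges ::
  "'b topology \<Rightarrow> 'i set \<Rightarrow> ('i \<times> 'i) set \<Rightarrow> ('i \<Rightarrow> 'b) \<Rightarrow> 'b \<Rightarrow> bool" where
  "net_converges X D r x l \<longleftrightarrow> l \<in> topspace X \<and>
     (\<forall>U. openin X U \<and> l \<in> U \<longrightarrow> (\<exists>a0\<in>D. \<forall>a\<in>D. (a0, a) \<in> r \<longrightarrow> x a \<in> U))"

definition net_Cauchy ::
  "'b::ab_group_add topology \<Rightarrow> 'i set \<Rightarrow> ('i \<times> 'i) set \<Rightarrow> ('i \<Rightarrow> 'b) \<Rightarrow> bool" where
  "net_Cauchy X D r x \<longleftrightarrow>
     (\<forall>V. 0 \<in> X interior_of V \<longrightarrow>
       (\<exists>a0\<in>D. \<forall>a\<in>D. \<forall>b\<in>D. (a0, a) \<in> r \<and> (a0, b) \<in> r \<longrightarrow> x a - x b \<in> V))"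

text \<open>
  Completeness of the topological group with underlying set \<^term>\<open>topspace X\<close>.  A definition
  cannot quantify over all index types; index sets in \<^typ>\<open>'b \<times> 'b set\<close> suffice, since
  by \<open>complete_group_net\<close> below the Cauchy nets over every other index type then converge
  as well.
\<close>

definition complete_group :: "'b::ab_group_add topology \<Rightarrow> bool" where
  "complete_group X \<longleftrightarrow>
     (\<forall>(D :: ('b \<times> 'b set) set) r x.
        directed D r \<and> (\<forall>a\<in>D. x a \<in> topspace X) \<and> net_Cauchy X D r x \<longrightarrow>
        (\<exists>l. net_converges X D r x l))"

lemma complete_group_net:
  fixes X :: "'b::ab_group_add topology" and D :: "'i set"
  assumes C: "complete_group X" and D: "directed D r"
    and x: "\<And>a. a \<in> D \<Longrightarrow> x a \<in> topspace X" and Ca: "net_Cauchy X D r x"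
  shows "\<exists>l. net_converges X D r x l"
proof -
  define t where "t a = x ` {b \<in> D. (a, b) \<in> r}" for a
  define E where "E = {(y, F). y \<in> F \<and> F \<in> t ` D}"
  define q :: "(('b \<times> 'b set) \<times> ('b \<times> 'b set)) set"
    where "q = {(p, p'). p \<in> E \<and> p' \<in> E \<and> snd p' \<subseteq> snd p}"
  have rfl: "(a, a) \<in> r" if "a \<in> D" for a
    using D that by (auto simp: directed_def preorder_on_def refl_on_def)
  have tr: "(a, c) \<in> r" if "(a, b) \<in> r" "(b, c) \<in> r" for a b c
    using D that by (meson directed_def preorder_on_def transD)
  have inE: "(x a, t a) \<in> E" if "a \<in> D" for a
    using that rfl by (auto simp: E_def t_def)
  have anti: "t b \<subseteq> t a" if "(a, b) \<in> r" for a b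
    using that tr by (auto simp: t_def)
  have dirE: "directed E q"
    unfolding directed_def
  proof (intro conjI ballI)
    show "E \<noteq> {}" using D inE by (auto simp: directed_def)
    show "preorder_on E q"
      by (auto simp: preorder_on_def refl_on_def trans_def q_def)
    fix p p' assume p: "p \<in> E" and p': "p' \<in> E"
    obtain a where a: "a \<in> D" "snd p = t a" using p by (auto simp: E_def)
    obtain b where b: "b \<in> D" "snd p' = t b" using p' by (auto simp: E_def)
    obtain c where c: "c \<in> D" "(a, c) \<in> r" "(b, c) \<in> r"
      using D a(1) b(1) unfolding directed_def by blast
    have "(p, (x c, t c)) \<in> q" "(p', (x c, t c)) \<in> q"
      using p p' inE[OF c(1)] anti[OF c(2)] anti[OF c(3)] a b by (auto simp: q_def)
    then show "\<exists>c\<in>E. (p, c) \<in> q \<and> (p', c) \<in> q" using inE[OF c(1)] by blast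
  qed
  have top: "\<forall>p\<in>E. fst p \<in> topspace X"
    using x by (auto simp: E_def t_def)
  have CaE: "net_Cauchy X E q fst"
    unfolding net_Cauchy_def
  proof (intro allI impI)
    fix V assume "0 \<in> X interior_of V"
    then obtain a0 where a0: "a0 \<in> D"
      "\<And>a b. \<lbrakk>a \<in> D; b \<in> D; (a0, a) \<in> r; (a0, b) \<in> r\<rbrakk> \<Longrightarrow> x a - x b \<in> V"
      using Ca unfolding net_Cauchy_def by blast
    have "fst p - fst p' \<in> V"
      if "((x a0, t a0), p) \<in> q" "((x a0, t a0), p') \<in> q" for p p'
    proof -
      have "fst p \<in> t a0" "fst p' \<in> t a0" using that by (auto simp: q_def E_def)
      then show ?thesis using a0(2) by (auto simp: t_def)
    qed
    then show "\<exists>p0\<in>E. \<forall>p\<in>E. \<forall>p'\<in>E. (p0, p) \<in> q \<and> (p0, p') \<in> q \<longrightarrow> fst p - fst p' \<in> V"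
      using inE[OF a0(1)] by blast
  qed
  obtain l where l: "net_converges X E q fst l"
    using C dirE top CaE unfolding complete_group_def by blast
  have "net_converges X D r x l"
    unfolding net_converges_def
  proof (intro conjI allI impI)
    show "l \<in> topspace X" using l by (simp add: net_converges_def)
    fix U assume "openin X U \<and> l \<in> U"
    then obtain p0 where p0: "p0 \<in> E" "\<And>p. p \<in> E \<Longrightarrow> (p0, p) \<in> q \<Longrightarrow> fst p \<in> U"
      using l unfolding net_converges_def by blast
    obtain a0 where a0: "a0 \<in> D" "snd p0 = t a0" using p0(1) by (auto simp: E_def)
    have "x a \<in> U" if "a \<in> D" "(a0, a) \<in> r" for a
    proof -
      have "(x a, t a0) \<in> E" using that a0 by (auto simp: E_def t_def)
      then show ?thesis using p0 a0 by (force simp: q_def)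
    qed
    then show "\<exists>a0\<in>D. \<forall>a\<in>D. (a0, a) \<in> r \<longrightarrow> x a \<in> U" using a0(1) by blast
  qed
  then show ?thesis by blast
qed

lemma nbhd_0_halve:
  fixes U :: "'a::topological_ab_group_add set"
  assumes "0 \<in> interior U"
  shows "\<exists>V. 0 \<in> interior V \<and> (\<forall>x\<in>V. \<forall>y\<in>V. x + y \<in> U)"
proof -
  have "((\<lambda>p. fst p + snd p) \<longlongrightarrow> 0 + (0::'a)) (nhds 0 \<times>\<^sub>F nhds 0)"
    by (rule tendsto_add_Pair)
  then have "eventually (\<lambda>p. fst p + snd p \<in> interior U) (nhds 0 \<times>\<^sub>F nhds (0::'a))"
    by (rule topological_tendstoD) (use assms in auto)
  then obtain P Q where PQ: "eventually P (nhds (0::'a))" "eventually Q (nhds (0::'a))"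
    "\<And>x y. P x \<Longrightarrow> Q y \<Longrightarrow> x + y \<in> interior U"
    unfolding eventually_prod_filter by auto
  then have "eventually (\<lambda>x. P x \<and> Q x) (nhds 0)" by (simp add: eventually_conj)
  then obtain W where W: "open W" "0 \<in> W" "\<And>x. x \<in> W \<Longrightarrow> P x \<and> Q x"
    unfolding eventually_nhds by blast
  have "0 \<in> interior W" using W by (simp add: interior_open)
  moreover have "\<forall>x\<in>W. \<forall>y\<in>W. x + y \<in> U" using W(3) PQ(3) interior_subset by blast
  ultimately show ?thesis by blast
qed

lemma nbhd_0_minus:
  fixes U :: "'a::topological_ab_group_add set"
  assumes "0 \<in> interior U"
  shows "0 \<in> interior (uminus ` U)"
proof -
  have "(uminus \<longlongrightarrow> - (0::'a)) (nhds 0)" by (rule tendsto_uminus_nhds)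
  then have "eventually (\<lambda>x::'a. - x \<in> interior U) (nhds 0)"
    by (rule topological_tendstoD) (use assms in auto)
  then obtain W where W: "open W" "0 \<in> W" "\<And>x. x \<in> W \<Longrightarrow> - x \<in> interior U"
    unfolding eventually_nhds by blast
  have "W \<subseteq> uminus ` U"
  proof
    fix x assume "x \<in> W"
    then have "- x \<in> U" using W(3) interior_subset by blast
    then have "- (- x) \<in> uminus ` U" by (rule imageI)
    then show "x \<in> uminus ` U" by simp
  qed
  then show ?thesis using W interiorI by blast
qed

lemma nfold_sum_add:
  assumes "x \<in> nfold_sum U m" "y \<in> nfold_sum U n"
  shows "x + y \<in> nfold_sum U (m + n)"
proof -
  obtain u where u: "x = (\<Sum>i<m. u i)" "\<forall>i<m. u i \<in> U"
    using assms(1) by (auto simp: nfold_sum_def)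
  obtain v where v: "y = (\<Sum>i<n. v i)" "\<forall>i<n. v i \<in> U"
    using assms(2) by (auto simp: nfold_sum_def)
  define w where "w i = (if i < m then u i else v (i - m))" for i
  have "(\<Sum>i<m + n. w i) = (\<Sum>i<m. w i) + (\<Sum>i<n. w (m + i))"
    by (induction n) (simp_all add: add.assoc)
  also have "\<dots> = x + y" by (simp add: w_def u v)
  finally have "x + y = (\<Sum>i<m + n. w i)" by simp
  moreover have "\<forall>i<m + n. w i \<in> U" using u v by (auto simp: w_def)
  ultimately show ?thesis unfolding nfold_sum_def by blast
qed

lemma nfold_sum_mono:
  assumes "0 \<in> U" "m \<le> n" shows "nfold_sum U m \<subseteq> nfold_sum U n"
proof
  fix x assume x: "x \<in> nfold_sum U m"
  have "0 \<in> nfold_sum U (n - m)"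
    using assms(1) by (auto simp: nfold_sum_def intro!: exI[of _ "\<lambda>_. 0"])
  from nfold_sum_add[OF x this] assms(2) show "x \<in> nfold_sum U n" by simp
qed

lemma nfold_sum_minus:
  fixes U :: "'a::ab_group_add set"
  shows "x \<in> nfold_sum (uminus ` U) n \<Longrightarrow> - x \<in> nfold_sum U n"
proof -
  assume "x \<in> nfold_sum (uminus ` U) n"
  then obtain u where u: "x = (\<Sum>i<n. u i)" "\<forall>i<n. u i \<in> uminus ` U"
    by (auto simp: nfold_sum_def)
  have "- x = (\<Sum>i<n. - u i)" using u by (simp add: sum_negf)
  moreover have "\<forall>i<n. - u i \<in> U" using u by fastforce
  ultimately show ?thesis unfolding nfold_sum_def by (auto intro!: exI[of _ "\<lambda>i. - u i"])
qed

lemma group_bounded_subset: "group_bounded B \<Longrightarrow> A \<subseteq> B \<Longrightarrow> group_bounded A"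
  unfolding group_bounded_def by (meson order_trans)

lemma group_bounded_empty: "group_bounded {}"
  unfolding group_bounded_def by auto

lemma group_bounded_Un:
  assumes "group_bounded A" "group_bounded B" shows "group_bounded (A \<union> B)"
  unfolding group_bounded_def
proof (intro allI impI)
  fix U :: "'a set" assume U: "0 \<in> interior U"
  obtain m n where mn: "m > 0" "A \<subseteq> nfold_sum U m" "n > 0" "B \<subseteq> nfold_sum U n"
    using assms U unfolding group_bounded_def by meson
  have "0 \<in> U" using U interior_subset by blast
  then have "A \<subseteq> nfold_sum U (m + n)" "B \<subseteq> nfold_sum U (m + n)"
    using mn nfold_sum_mono[of U m "m + n"] nfold_sum_mono[of U n "m + n"] by auto
  then show "\<exists>n>0. A \<union> B \<subseteq> nfold_sum U n" using mn by (intro exI[of _ "m + n"]) auto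
qed

lemma group_bounded_minus:
  assumes "group_bounded A" shows "group_bounded (uminus ` A)"
  unfolding group_bounded_def
proof (intro allI impI)
  fix U :: "'a set" assume "0 \<in> interior U"
  then obtain n where n: "n > 0" "A \<subseteq> nfold_sum (uminus ` U) n"
    using assms nbhd_0_minus unfolding group_bounded_def by meson
  then have "uminus ` A \<subseteq> nfold_sum U n" using nfold_sum_minus by blast
  then show "\<exists>n>0. uminus ` A \<subseteq> nfold_sum U n" using n by blast
qed

lemma group_bounded_add:
  assumes "group_bounded A" "group_bounded B"
  shows "group_bounded {a + b | a b. a \<in> A \<and> b \<in> B}"
  unfolding group_bounded_def
proof (intro allI impI)
  fix U :: "'a set" assume U: "0 \<in> interior U"
  obtain m n where mn: "m > 0" "A \<subseteq> nfold_sum U m" "n > 0" "B \<subseteq> nfold_sum U n"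
    using assms U unfolding group_bounded_def by meson
  have "{a + b | a b. a \<in> A \<and> b \<in> B} \<subseteq> nfold_sum U (m + n)"
    using mn by (auto intro!: nfold_sum_add)
  then show "\<exists>n>0. {a + b | a b. a \<in> A \<and> b \<in> B} \<subseteq> nfold_sum U n"
    using mn by (intro exI[of _ "m + n"]) auto
qed

lemma hom_bb_zero: "0 \<in> hom_bb"
proof -
  have "group_bounded ((0 :: 'a \<Rightarrow> 'a) ` B)" for B :: "'a set"
    unfolding group_bounded_def
  proof (intro allI impI)
    fix U :: "'a set" assume "0 \<in> interior U"
    then have "0 \<in> U" using interior_subset by blast
    then have "(0 :: 'a \<Rightarrow> 'a) ` B \<subseteq> nfold_sum U 1" by (auto simp: nfold_sum_def)
    then show "\<exists>n>0. (0 :: 'a \<Rightarrow> 'a) ` B \<subseteq> nfold_sum U n" by (intro exI[of _ 1]) auto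
  qed
  then show ?thesis by (auto simp: hom_bb_def additive_def)
qed

lemma hom_bb_add:
  assumes "S \<in> hom_bb" "T \<in> hom_bb" shows "S + T \<in> hom_bb"
proof -
  have "group_bounded ((S + T) ` B)" if "group_bounded B" for B
    by (rule group_bounded_subset[OF group_bounded_add[of "S ` B" "T ` B"]])
      (use assms that in \<open>auto simp: hom_bb_def\<close>)
  then show ?thesis using assms by (auto simp: hom_bb_def additive_def algebra_simps)
qed

lemma hom_bb_minus:
  assumes "T \<in> hom_bb" shows "- T \<in> hom_bb"
proof -
  have "group_bounded ((- T) ` B)" if "group_bounded B" for B
    by (rule group_bounded_subset[OF group_bounded_minus[of "T ` B"]])
      (use assms that in \<open>auto simp: hom_bb_def fun_Compl_def\<close>)
  then show ?thesis using assms by (auto simp: hom_bb_def additive_def fun_Compl_def)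
qed

lemma hom_bb_diff: "S \<in> hom_bb \<Longrightarrow> T \<in> hom_bb \<Longrightarrow> S - T \<in> hom_bb"
  using hom_bb_add[OF _ hom_bb_minus, of S T] by (simp add: algebra_simps)

lemma openin_ucb:
  "openin ucb_topology X \<longleftrightarrow> X \<subseteq> hom_bb \<and>
     (\<forall>S\<in>X. \<exists>B V. group_bounded B \<and> 0 \<in> interior V \<and> ucb_ball S B V \<subseteq> X)"
proof -
  let ?P = "\<lambda>X :: ('a \<Rightarrow> 'a) set. X \<subseteq> hom_bb \<and>
     (\<forall>S\<in>X. \<exists>B V. group_bounded B \<and> 0 \<in> interior V \<and> ucb_ball S B V \<subseteq> X)"
  have "istopology ?P"
    unfolding istopology_def
  proof (rule conjI; intro allI impI)
    fix X Y assume X: "?P X" and Y: "?P Y"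
    show "?P (X \<inter> Y)"
    proof (intro conjI ballI)
      show "X \<inter> Y \<subseteq> hom_bb" using X by auto
      fix S assume S: "S \<in> X \<inter> Y"
      obtain A V where A: "group_bounded A" "0 \<in> interior V" "ucb_ball S A V \<subseteq> X"
        using X S by blast
      obtain B W where B: "group_bounded B" "0 \<in> interior W" "ucb_ball S B W \<subseteq> Y"
        using Y S by blast
      have "ucb_ball S (A \<union> B) (V \<inter> W) \<subseteq> X \<inter> Y"
        using A(3) B(3) unfolding ucb_ball_def by blast
      moreover have "0 \<in> interior (V \<inter> W)" using A B by simp
      ultimately show "\<exists>B V. group_bounded B \<and> 0 \<in> interior V \<and> ucb_ball S B V \<subseteq> X \<inter> Y"
        using group_bounded_Un[OF A(1) B(1)] by blast
    qed
  next
    fix K assume K: "\<forall>X\<in>K. ?P X"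
    show "?P (\<Union>K)"
    proof (intro conjI ballI)
      show "\<Union>K \<subseteq> hom_bb" using K by auto
      fix S assume "S \<in> \<Union>K"
      then obtain X where X: "X \<in> K" "S \<in> X" by blast
      then obtain B V where "group_bounded B" "0 \<in> interior V" "ucb_ball S B V \<subseteq> X"
        using K by blast
      then show "\<exists>B V. group_bounded B \<and> 0 \<in> interior V \<and> ucb_ball S B V \<subseteq> \<Union>K"
        using X(1) by blast
    qed
  qed
  then show ?thesis unfolding ucb_topology_def by (simp add: topology_inverse')
qed

lemma topspace_ucb [simp]:
  "topspace ucb_topology = (hom_bb :: ('a::topological_ab_group_add \<Rightarrow> 'a) set)"
proof -
  have "group_bounded {} \<and> 0 \<in> interior UNIV \<and> ucb_ball S {} UNIV \<subseteq> hom_bb" for S :: "'a \<Rightarrow> 'a"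
    using group_bounded_empty by (auto simp: ucb_ball_def)
  then have "openin ucb_topology (hom_bb :: ('a \<Rightarrow> 'a) set)"
    unfolding openin_ucb by blast
  then have "(hom_bb :: ('a \<Rightarrow> 'a) set) \<subseteq> topspace ucb_topology" by (rule openin_subset)
  moreover have "topspace ucb_topology \<subseteq> (hom_bb :: ('a \<Rightarrow> 'a) set)"
    using openin_topspace openin_ucb by blast
  ultimately show ?thesis by blast
qed

lemma ucb_ball_nbhd:
  assumes S: "S \<in> hom_bb" and B: "group_bounded B" and V: "0 \<in> interior V"
  shows "S \<in> ucb_topology interior_of ucb_ball S B V"
proof -
  define X where "X = {R \<in> hom_bb. \<exists>W. 0 \<in> interior W \<and> (\<forall>b\<in>B. \<forall>w\<in>W. (R - S) b + w \<in> V)}"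
  have "openin ucb_topology X"
    unfolding openin_ucb
  proof (intro conjI ballI)
    show "X \<subseteq> hom_bb" by (auto simp: X_def)
    fix R assume "R \<in> X"
    then obtain W where W: "0 \<in> interior W" "\<forall>b\<in>B. \<forall>w\<in>W. (R - S) b + w \<in> V"
      by (auto simp: X_def)
    obtain W' where W': "0 \<in> interior W'" "\<forall>x\<in>W'. \<forall>y\<in>W'. x + y \<in> W"
      using nbhd_0_halve[OF W(1)] by blast
    have "ucb_ball R B W' \<subseteq> X"
    proof
      fix Q assume Q: "Q \<in> ucb_ball R B W'"
      have "(Q - S) b + w \<in> V" if "b \<in> B" "w \<in> W'" for b w
      proof -
        have "(Q - R) b \<in> W'" using Q that(1) unfolding ucb_ball_def by blast
        then have "(R - S) b + ((Q - R) b + w) \<in> V" using W W' that by blast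
        moreover have "(R - S) b + ((Q - R) b + w) = (Q - S) b + w"
          by (simp add: algebra_simps)
        ultimately show ?thesis by (simp only:)
      qed
      then show "Q \<in> X" using Q W'(1) unfolding X_def ucb_ball_def by blast
    qed
    then show "\<exists>B V. group_bounded B \<and> 0 \<in> interior V \<and> ucb_ball R B V \<subseteq> X"
      using B W'(1) by blast
  qed
  moreover have "S \<in> X" using S V by (auto simp: X_def)
  moreover have "X \<subseteq> ucb_ball S B V"
  proof
    fix R assume "R \<in> X"
    then obtain W where W: "R \<in> hom_bb" "0 \<in> interior W" "\<forall>b\<in>B. \<forall>w\<in>W. (R - S) b + w \<in> V"
      by (auto simp: X_def)
    have "0 \<in> W" using W(2) interior_subset by blast
    then have "(R - S) b \<in> V" if "b \<in> B" for b using W(3) that by force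
    then show "R \<in> ucb_ball S B V" using W(1) unfolding ucb_ball_def by blast
  qed
  ultimately show ?thesis unfolding interior_of_def by blast
qed

lemma ucb_interior_ball:
  assumes "S \<in> ucb_topology interior_of U"
  shows "\<exists>B V. group_bounded B \<and> 0 \<in> interior V \<and> ucb_ball S B V \<subseteq> U"
  using assms unfolding interior_of_def openin_ucb by blast

lemma net_converges_ucb_iff:
  assumes x: "\<And>a. a \<in> D \<Longrightarrow> x a \<in> hom_bb"
  shows "net_converges ucb_topology D r x S \<longleftrightarrow> S \<in> hom_bb \<and>
    (\<forall>B V. group_bounded B \<and> 0 \<in> interior V \<longrightarrow>
      (\<exists>a0\<in>D. \<forall>a\<in>D. (a0, a) \<in> r \<longrightarrow> (x a - S) ` B \<subseteq> V))" (is "?L \<longleftrightarrow> ?R")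
proof
  assume L: ?L
  then have S: "S \<in> hom_bb" by (simp add: net_converges_def)
  have "\<exists>a0\<in>D. \<forall>a\<in>D. (a0, a) \<in> r \<longrightarrow> (x a - S) ` B \<subseteq> V"
    if "group_bounded B" "0 \<in> interior V" for B V
  proof -
    let ?I = "ucb_topology interior_of ucb_ball S B V"
    have "openin ucb_topology ?I" "S \<in> ?I" using ucb_ball_nbhd[OF S that] by auto
    then obtain a0 where "a0 \<in> D" "\<forall>a\<in>D. (a0, a) \<in> r \<longrightarrow> x a \<in> ?I"
      using L unfolding net_converges_def by blast
    then show ?thesis
      using interior_of_subset[of ucb_topology "ucb_ball S B V"] unfolding ucb_ball_def by blast
  qed
  with S show ?R by blast
next
  assume R: ?R
  show ?L
    unfolding net_converges_def
  proof (intro conjI allI impI)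
    show "S \<in> topspace ucb_topology" using R by simp
    fix U assume U: "openin ucb_topology U \<and> S \<in> U"
    then obtain B V where BV: "group_bounded B" "0 \<in> interior V" "ucb_ball S B V \<subseteq> U"
      unfolding openin_ucb by blast
    then obtain a0 where "a0 \<in> D" "\<forall>a\<in>D. (a0, a) \<in> r \<longrightarrow> (x a - S) ` B \<subseteq> V"
      using R by blast
    then show "\<exists>a0\<in>D. \<forall>a\<in>D. (a0, a) \<in> r \<longrightarrow> x a \<in> U"
      using BV(3) x unfolding ucb_ball_def by blast
  qed
qed

lemma net_Cauchy_ucb_iff:
  fixes x :: "'i \<Rightarrow> 'a::topological_ab_group_add \<Rightarrow> 'a"
  assumes x: "\<And>a. a \<in> D \<Longrightarrow> x a \<in> hom_bb"
  shows "net_Cauchy ucb_topology D r x \<longleftrightarrow>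
    (\<forall>B V. group_bounded B \<and> 0 \<in> interior V \<longrightarrow>
      (\<exists>a0\<in>D. \<forall>a\<in>D. \<forall>b\<in>D. (a0, a) \<in> r \<and> (a0, b) \<in> r \<longrightarrow> (x a - x b) ` B \<subseteq> V))"
    (is "?L \<longleftrightarrow> ?R")
proof
  assume L: ?L
  show ?R
  proof (intro allI impI)
    fix B V :: "'a set" assume "group_bounded B \<and> 0 \<in> interior V"
    then have "0 \<in> ucb_topology interior_of ucb_ball 0 B V"
      using ucb_ball_nbhd[OF hom_bb_zero] by blast
    then obtain a0 where "a0 \<in> D"
      "\<forall>a\<in>D. \<forall>b\<in>D. (a0, a) \<in> r \<and> (a0, b) \<in> r \<longrightarrow> x a - x b \<in> ucb_ball 0 B V"
      using L unfolding net_Cauchy_def by meson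
    then show "\<exists>a0\<in>D. \<forall>a\<in>D. \<forall>b\<in>D. (a0, a) \<in> r \<and> (a0, b) \<in> r \<longrightarrow> (x a - x b) ` B \<subseteq> V"
      unfolding ucb_ball_def diff_zero by blast
  qed
next
  assume R: ?R
  show ?L
    unfolding net_Cauchy_def
  proof (intro allI impI)
    fix U :: "('a \<Rightarrow> 'a) set" assume "0 \<in> ucb_topology interior_of U"
    then obtain B V :: "'a set" where BV: "group_bounded B" "0 \<in> interior V" "ucb_ball 0 B V \<subseteq> U"
      using ucb_interior_ball by blast
    obtain a0 where a0: "a0 \<in> D"
      "\<forall>a\<in>D. \<forall>b\<in>D. (a0, a) \<in> r \<and> (a0, b) \<in> r \<longrightarrow> (x a - x b) ` B \<subseteq> V"
      using R BV by meson
    have "x a - x b \<in> U" if "a \<in> D" "b \<in> D" "(a0, a) \<in> r" "(a0, b) \<in> r" for a b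
    proof -
      have "x a - x b \<in> hom_bb" using x that by (simp add: hom_bb_diff)
      moreover have "(x a - x b) ` B \<subseteq> V" using a0 that by blast
      ultimately have "x a - x b \<in> ucb_ball 0 B V" unfolding ucb_ball_def diff_zero by blast
      then show ?thesis using BV(3) by blast
    qed
    then show "\<exists>a0\<in>D. \<forall>a\<in>D. \<forall>b\<in>D. (a0, a) \<in> r \<and> (a0, b) \<in> r \<longrightarrow> x a - x b \<in> U"
      using a0(1) by blast
  qed
qed

end

theory Submission
  imports Defs
begin

text \<open>
  Singletons are bounded, so a Cauchy net of homomorphisms in \<open>hom_bb\<close> is Cauchy at
  every point, and completeness of \<open>G\<close> provides a pointwise limit \<open>L\<close>.  Three things remain.

  The limit is additive, because limits in a Hausdorff group are unique and commute with
  addition.  The convergence is uniform on every bounded set \<open>B\<close>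
  (\<open>Cauchy_pointwise_limit_uniform\<close>): the estimate for \<open>T\<^sub>a - T\<^sub>c\<close> on \<open>B\<close> holds for all large
  \<open>a\<close> and \<open>c\<close> simultaneously, and at each point of \<open>B\<close> one may choose its own \<open>c\<close> so large that
  \<open>T\<^sub>c\<close> is close to \<open>L\<close> there.  Finally \<open>L\<close> maps bounded sets to bounded sets
  (\<open>group_bounded_image_near\<close>): on \<open>B\<close> it differs from a single \<open>T\<^sub>a\<close> by elements of a given
  neighborhood \<open>U\<close> of \<open>0\<close>, which costs one more summand from \<open>U\<close>.

  Limits of nets are treated as limits along the filter generated by the tails of the index set,
  which makes the calculus of limits of filters available.
\<close>

definition tail_filter :: "'i set \<Rightarrow> ('i \<times> 'i) set \<Rightarrow> 'i filter" where
  "tail_filter D r = (INF a0\<in>D. principal {a \<in> D. (a0, a) \<in> r})"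

lemma eventually_tail_filter:
  assumes "directed D r"
  shows "eventually P (tail_filter D r) \<longleftrightarrow> (\<exists>a0\<in>D. \<forall>a\<in>D. (a0, a) \<in> r \<longrightarrow> P a)"
proof -
  have tr: "(a, c) \<in> r" if "(a, b) \<in> r" "(b, c) \<in> r" for a b c
    using assms that by (meson directed_def preorder_on_def transD)
  have "\<exists>c\<in>D. principal {d \<in> D. (c, d) \<in> r}
      \<le> inf (principal {d \<in> D. (a, d) \<in> r}) (principal {d \<in> D. (b, d) \<in> r})"
    if ab: "a \<in> D" "b \<in> D" for a b
  proof -
    obtain c where c: "c \<in> D" "(a, c) \<in> r" "(b, c) \<in> r"
      using assms ab unfolding directed_def by blast
    then have "{d \<in> D. (c, d) \<in> r} \<subseteq> {d \<in> D. (a, d) \<in> r} \<inter> {d \<in> D. (b, d) \<in> r}"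
      using tr by blast
    then show ?thesis using c(1) by auto
  qed
  moreover have "D \<noteq> {}" using assms by (simp add: directed_def)
  ultimately show ?thesis
    unfolding tail_filter_def by (subst eventually_INF_base) (auto simp: eventually_principal)
qed

lemma tail_filter_neq_bot:
  assumes "directed D r"
  shows "tail_filter D r \<noteq> bot"
proof -
  have "(a, a) \<in> r" if "a \<in> D" for a
    using assms that by (auto simp: directed_def preorder_on_def refl_on_def)
  then show ?thesis
    using eventually_tail_filter[OF assms, of "\<lambda>_. False"] by (auto simp: trivial_limit_def)
qed

lemma net_converges_euclidean_iff:
  assumes "directed D r"
  shows "net_converges euclidean D r x l \<longleftrightarrow> (x \<longlongrightarrow> l) (tail_filter D r)"
  unfolding net_converges_def tendsto_def eventually_tail_filter[OF assms] by auto

lemma tendsto_eventually_diff: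
  fixes l :: "'a::topological_ab_group_add"
  assumes "(x \<longlongrightarrow> l) F" "0 \<in> interior V"
  shows "eventually (\<lambda>a. x a - l \<in> V) F"
proof -
  have "((\<lambda>a. x a - l) \<longlongrightarrow> l - l) F"
    by (intro tendsto_diff assms(1) tendsto_const)
  then have "eventually (\<lambda>a. x a - l \<in> interior V) F"
    by (rule topological_tendstoD) (use assms(2) in auto)
  then show ?thesis
    by (rule eventually_mono) (use interior_subset in blast)
qed

lemma net_Cauchy_ucbD:
  fixes x :: "'i \<Rightarrow> 'a::topological_ab_group_add \<Rightarrow> 'a"
  assumes x: "\<And>a. a \<in> D \<Longrightarrow> x a \<in> hom_bb" and Ca: "net_Cauchy ucb_topology D r x"
    and B: "group_bounded B" and V: "0 \<in> interior V"
  obtains a0 where "a0 \<in> D"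
    "\<And>a c b. \<lbrakk>a \<in> D; c \<in> D; (a0, a) \<in> r; (a0, c) \<in> r; b \<in> B\<rbrakk> \<Longrightarrow> x a b - x c b \<in> V"
proof -
  have "net_Cauchy ucb_topology D r x \<longleftrightarrow>
    (\<forall>B V. group_bounded B \<and> 0 \<in> interior V \<longrightarrow>
      (\<exists>a0\<in>D. \<forall>a\<in>D. \<forall>c\<in>D. (a0, a) \<in> r \<and> (a0, c) \<in> r \<longrightarrow> (x a - x c) ` B \<subseteq> V))"
    by (rule net_Cauchy_ucb_iff) (rule x)
  then have "\<exists>a0\<in>D. \<forall>a\<in>D. \<forall>c\<in>D. (a0, a) \<in> r \<and> (a0, c) \<in> r \<longrightarrow> (x a - x c) ` B \<subseteq> V"
    using Ca B V by simp
  then obtain a0 where a0: "a0 \<in> D"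
    "\<forall>a\<in>D. \<forall>c\<in>D. (a0, a) \<in> r \<and> (a0, c) \<in> r \<longrightarrow> (x a - x c) ` B \<subseteq> V" ..
  show thesis
  proof (rule that[OF a0(1)])
    fix a c b assume *: "a \<in> D" "c \<in> D" "(a0, a) \<in> r" "(a0, c) \<in> r" "b \<in> B"
    then have "(x a - x c) ` B \<subseteq> V" using a0(2) by blast
    then show "x a b - x c b \<in> V" using *(5) by auto
  qed
qed

lemma net_Cauchy_ucb_pointwise:
  fixes x :: "'i \<Rightarrow> 'a::topological_ab_group_add \<Rightarrow> 'a"
  assumes x: "\<And>a. a \<in> D \<Longrightarrow> x a \<in> hom_bb" and Ca: "net_Cauchy ucb_topology D r x"
    and y: "group_bounded {y}"
  shows "net_Cauchy euclidean D r (\<lambda>a. x a y)"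
  unfolding net_Cauchy_def
proof (intro allI impI)
  fix V :: "'a set" assume "0 \<in> euclidean interior_of V"
  then have V: "0 \<in> interior V" by (auto simp: interior_of_def interior_def)
  show "\<exists>a0\<in>D. \<forall>a\<in>D. \<forall>b\<in>D. (a0, a) \<in> r \<and> (a0, b) \<in> r \<longrightarrow> x a y - x b y \<in> V"
    by (rule net_Cauchy_ucbD[OF x Ca y V]) auto
qed

text \<open>
  The index \<open>c\<close> through which \<open>x a b\<close> is compared with \<open>L b\<close> depends on \<open>b\<close>, but
  the index beyond which the conclusion holds comes from the Cauchy condition alone.
\<close>

lemma Cauchy_pointwise_limit_uniform:
  fixes x :: "'i \<Rightarrow> 'a::topological_ab_group_add \<Rightarrow> 'a"
  assumes D: "directed D r" and x: "\<And>a. a \<in> D \<Longrightarrow> x a \<in> hom_bb"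
    and Ca: "net_Cauchy ucb_topology D r x"
    and L: "\<And>y. ((\<lambda>a. x a y) \<longlongrightarrow> L y) (tail_filter D r)"
    and B: "group_bounded B" and V: "0 \<in> interior V"
  shows "\<exists>a0\<in>D. \<forall>a\<in>D. (a0, a) \<in> r \<longrightarrow> (x a - L) ` B \<subseteq> V"
proof -
  obtain W where W: "0 \<in> interior W" "\<forall>u\<in>W. \<forall>v\<in>W. u + v \<in> V"
    using nbhd_0_halve[OF V] by blast
  obtain a0 where a0: "a0 \<in> D"
    "\<And>a c b. \<lbrakk>a \<in> D; c \<in> D; (a0, a) \<in> r; (a0, c) \<in> r; b \<in> B\<rbrakk> \<Longrightarrow> x a b - x c b \<in> W"
    by (rule net_Cauchy_ucbD[OF _ Ca B W(1)], erule x, rule that)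
  have "(x a - L) b \<in> V" if a: "a \<in> D" "(a0, a) \<in> r" and b: "b \<in> B" for a b
  proof -
    have "eventually (\<lambda>c. c \<in> D \<and> (a0, c) \<in> r) (tail_filter D r)"
      unfolding eventually_tail_filter[OF D] using a0(1) by blast
    moreover have "eventually (\<lambda>c. x c b - L b \<in> W) (tail_filter D r)"
      by (rule tendsto_eventually_diff[OF L W(1)])
    ultimately have "eventually (\<lambda>c. (c \<in> D \<and> (a0, c) \<in> r) \<and> x c b - L b \<in> W) (tail_filter D r)"
      by (rule eventually_conj)
    then obtain c where c: "c \<in> D" "(a0, c) \<in> r" "x c b - L b \<in> W"
      using eventually_happens'[OF tail_filter_neq_bot[OF D]] by blast
    have "x a b - x c b \<in> W" by (rule a0(2)[OF a(1) c(1) a(2) c(2) b])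
    then have "(x a b - x c b) + (x c b - L b) \<in> V" using W(2) c(3) by blast
    then show ?thesis by simp
  qed
  then show ?thesis using a0(1) by blast
qed

text \<open>
  If \<open>n\<close> summands from \<open>U\<close> reach every point of \<open>T ` B\<close>, then \<open>n + 1\<close> reach every point of \<open>L ` B\<close>.
  Only one neighborhood is considered at a time, so the approximating \<open>T\<close> may depend on \<open>U\<close>.
\<close>

lemma group_bounded_image_near:
  fixes L :: "'b \<Rightarrow> 'a::topological_ab_group_add"
  assumes "\<And>U. 0 \<in> interior U \<Longrightarrow> \<exists>T. group_bounded (T ` B) \<and> (\<forall>b\<in>B. T b - L b \<in> U)"
  shows "group_bounded (L ` B)"
  unfolding group_bounded_def
proof (intro allI impI)
  fix U :: "'a set" assume U: "0 \<in> interior U"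
  \<comment> \<open>The closeness is asked for \<open>- U\<close>, because it is \<open>L b - T b\<close> that has to lie in \<open>U\<close>.\<close>
  obtain T where T: "group_bounded (T ` B)" "\<forall>b\<in>B. T b - L b \<in> uminus ` U"
    using assms[OF nbhd_0_minus[OF U]] by blast
  obtain n where n: "T ` B \<subseteq> nfold_sum U n"
    using T(1) U unfolding group_bounded_def by meson
  have "L b \<in> nfold_sum U (n + 1)" if b: "b \<in> B" for b
  proof -
    obtain u where u: "u \<in> U" "T b - L b = - u" using T(2) b by blast
    have "u \<in> nfold_sum U 1" using u(1) by (auto simp: nfold_sum_def intro!: exI[of _ "\<lambda>_. u"])
    then have "T b + u \<in> nfold_sum U (n + 1)" using n b by (intro nfold_sum_add) auto
    moreover have "T b + u = L b" using u(2) by (simp add: algebra_simps)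
    ultimately show ?thesis by simp
  qed
  then show "\<exists>n>0. L ` B \<subseteq> nfold_sum U n" by (intro exI[of _ "n + 1"]) auto
qed

lemma additive_tendsto:
  fixes x :: "'i \<Rightarrow> 'a::topological_ab_group_add \<Rightarrow> 'b::{topological_ab_group_add, t2_space}"
  assumes "F \<noteq> bot" "eventually (\<lambda>a. additive (x a)) F" "\<And>y. ((\<lambda>a. x a y) \<longlongrightarrow> L y) F"
  shows "additive L"
proof
  fix y z
  have "((\<lambda>a. x a y + x a z) \<longlongrightarrow> L y + L z) F" by (intro tendsto_add assms(3))
  moreover have "eventually (\<lambda>a. x a y + x a z = x a (y + z)) F"
    using assms(2) by (rule eventually_mono) (simp add: additive.add)
  ultimately have "((\<lambda>a. x a (y + z)) \<longlongrightarrow> L y + L z) F"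
    by (rule Lim_transform_eventually)
  then show "L (y + z) = L y + L z" using tendsto_unique[OF assms(1,3)] by blast
qed

theorem theorem2p14:
  assumes "\<And>x :: 'a :: {topological_ab_group_add, t2_space}. group_bounded {x}"
    and "complete_group (euclidean :: 'a topology)"
  shows "complete_group (ucb_topology :: ('a \<Rightarrow> 'a) topology)"
  unfolding complete_group_def
proof (intro allI impI)
  fix D :: "(('a \<Rightarrow> 'a) \<times> ('a \<Rightarrow> 'a) set) set" and r and x :: "_ \<Rightarrow> 'a \<Rightarrow> 'a"
  assume "directed D r \<and> (\<forall>a\<in>D. x a \<in> topspace ucb_topology) \<and> net_Cauchy ucb_topology D r x"
  then have D: "directed D r" and x: "\<And>a. a \<in> D \<Longrightarrow> x a \<in> hom_bb"
    and Ca: "net_Cauchy ucb_topology D r x" by auto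
  have "\<exists>l. ((\<lambda>a. x a y) \<longlongrightarrow> l) (tail_filter D r)" for y
  proof -
    have "net_Cauchy euclidean D r (\<lambda>a. x a y)"
      by (rule net_Cauchy_ucb_pointwise[OF _ Ca assms(1)]) (rule x)
    then have "\<exists>l. net_converges euclidean D r (\<lambda>a. x a y) l"
      by (intro complete_group_net[OF assms(2) D]) auto
    then show ?thesis by (simp add: net_converges_euclidean_iff[OF D])
  qed
  then obtain L where L: "\<And>y. ((\<lambda>a. x a y) \<longlongrightarrow> L y) (tail_filter D r)" by metis
  have uniform: "\<exists>a0\<in>D. \<forall>a\<in>D. (a0, a) \<in> r \<longrightarrow> (x a - L) ` B \<subseteq> V"
    if "group_bounded B" "0 \<in> interior V" for B V
    by (rule Cauchy_pointwise_limit_uniform[OF D _ Ca L that]) (rule x)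
  have "eventually (\<lambda>a. additive (x a)) (tail_filter D r)"
    using D x unfolding eventually_tail_filter[OF D] directed_def hom_bb_def by blast
  then have "additive L" by (rule additive_tendsto[OF tail_filter_neq_bot[OF D] _ L])
  moreover have "group_bounded (L ` B)" if B: "group_bounded B" for B
  proof (rule group_bounded_image_near)
    fix U :: "'a set" assume "0 \<in> interior U"
    then obtain a0 where a0: "a0 \<in> D" "\<forall>a\<in>D. (a0, a) \<in> r \<longrightarrow> (x a - L) ` B \<subseteq> U"
      using uniform[OF B] by blast
    have "(a0, a0) \<in> r"
      using D a0(1) by (auto simp: directed_def preorder_on_def refl_on_def)
    then have "(x a0 - L) ` B \<subseteq> U" using a0 by blast
    then have "\<forall>b\<in>B. x a0 b - L b \<in> U" by auto
    moreover have "group_bounded (x a0 ` B)" using x[OF a0(1)] B by (simp add: hom_bb_def)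
    ultimately show "\<exists>T. group_bounded (T ` B) \<and> (\<forall>b\<in>B. T b - L b \<in> U)" by blast
  qed
  ultimately have "L \<in> hom_bb" by (simp add: hom_bb_def)
  then have "net_converges ucb_topology D r x L"
    by (subst net_converges_ucb_iff) (use x uniform in auto)
  then show "\<exists>l. net_converges ucb_topology D r x l" by blast
qed

end
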